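(* Let $N\ge 2$. For each $x_0\in C_N^A$ there is a unique continuous function $x:[0,\infty[\to C_N^A$ with $x(0)=x_0$ such that $x(t)\in W_N^A$ for all $t\in\,]0,\infty[$ and such that $x:\,]0,\infty[\to W_N^A$ satisfies the ODE $$\frac{dx_i(t)}{dt}=\sum_{j\ne i}\frac{1}{x_i(t)-x_j(t)}\qquad (i=1,\ldots,N,\ t>0).$$
   Context: $C_N^A:=\{x\in\mathbb R^N:\ x_1\ge x_2\ge\cdots\ge x_N\}$ is the closed Weyl chamber of type $A_{N-1}$, and $W_N^A=\{x\in\mathbb R^N:\ x_1>x_2>\cdots>x_N\}$ is its interior. In sums $\sum_{j\neq i}$ the index $j$ runs over $\{1,\ldots,N\}\setminus\{i\}$. *)

theory Defs
  imports "HOL-Analysis.Analysis" "HOL-Library.FuncSet"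
begin

text \<open>
  Points of $\mathbb{R}^N$ are vectors over an arbitrary finite linearly ordered index type
  with $N$ elements. Such a type is order-isomorphic to $\{1 < 2 < \dots < N\}$, so smaller
  indices carry the larger coordinates.
\<close>

definition weyl_chamber_A :: "(real ^ 'n::{finite,linorder}) set" where
  "weyl_chamber_A = {x. \<forall>i j. i < j \<longrightarrow> x $ i \<ge> x $ j}"

definition weyl_interior_A :: "(real ^ 'n::{finite,linorder}) set" where
  "weyl_interior_A = {x. \<forall>i j. i < j \<longrightarrow> x $ i > x $ j}"

end

theory Submission
  imports Defs "HOL-Computational_Algebra.Fundamental_Theorem_Algebra"
begin

text \<open>
  The points $x(t)$ solve the ODE exactly when the monic polynomial $p_t$ with these roots solves
  the backward heat equation $\partial_t p = -p''/2$, because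
  $p''(x_i)/p'(x_i) = 2 \sum_{j \neq i} 1/(x_i - x_j)$. Hence $x(t)$ must be the ordered list of
  roots of $p_t = e^{-(t/2) D^2} p_0$. These roots are real, since $p_t$ is the limit of
  $(1 - (t/2n) D^2)^n p_0$ and each factor $1 - c^2 D^2 = (1 - c D)(1 + c D)$ preserves
  real-rootedness. They are simple for $t > 0$ by the Laguerre inequality, and they depend
  continuously on $t \ge 0$ by compactness. Uniqueness holds because the right-hand side is
  monotone decreasing, so that the distance of two solutions does not increase.
\<close>

subsection \<open>Real-rooted polynomials\<close>

abbreviation cpoly :: "real poly \<Rightarrow> complex poly"
  where "cpoly \<equiv> map_poly complex_of_real"

lemma cpoly_add: "cpoly (p + q) = cpoly p + cpoly q"
  by (simp add: poly_eq_iff coeff_map_poly)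

lemma cpoly_smult: "cpoly (smult c p) = smult (of_real c) (cpoly p)"
  by (simp add: poly_eq_iff coeff_map_poly)

lemma cpoly_mult: "cpoly (p * q) = cpoly p * cpoly q"
  by (simp add: poly_eq_iff coeff_map_poly coeff_mult)

lemma cpoly_sum: "cpoly (\<Sum>i\<in>A. f i) = (\<Sum>i\<in>A. cpoly (f i))"
  by (simp add: poly_eq_iff coeff_map_poly coeff_sum)

lemma cpoly_linear: "cpoly [:-r, 1:] = [:- of_real r, 1:]"
  by (simp add: map_poly_pCons)

lemma poly_cpoly_of_real: "poly (cpoly p) (of_real x) = of_real (poly p x)"
  by (induction p) (auto simp: map_poly_pCons)

lemma poly_cpoly_cnj: "poly (cpoly p) (cnj z) = cnj (poly (cpoly p) z)"
  by (induction p) (auto simp: map_poly_pCons)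

text \<open>The explicit splitting allows induction over the list of roots, with multiplicity. The
  case \<open>c = 0\<close> admits the zero polynomial, so the class is closed under
  derivatives.\<close>

definition real_rooted :: "real poly \<Rightarrow> bool"
  where "real_rooted p \<longleftrightarrow> (\<exists>c rs. p = smult c (\<Prod>r\<leftarrow>rs. [:-r, 1:]))"

lemma real_rooted_0 [simp]: "real_rooted 0"
  unfolding real_rooted_def by (metis smult_0_left)

lemma real_rooted_mult_linear:
  assumes "real_rooted p"
  shows "real_rooted ([:-r, 1:] * p)"
proof -
  obtain c rs where "p = smult c (\<Prod>r\<leftarrow>rs. [:-r, 1:])"
    using assms by (auto simp: real_rooted_def)
  then have "[:-r, 1:] * p = smult c (\<Prod>r\<leftarrow>r # rs. [:-r, 1:])"
    by simp
  then show ?thesis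
    unfolding real_rooted_def by blast
qed

lemma real_rooted_smult: "real_rooted p \<Longrightarrow> real_rooted (smult a p)"
  unfolding real_rooted_def by (metis smult_smult)

text \<open>By induction on the degree: the fundamental theorem of algebra yields a complex zero,
  which is real by assumption, and its linear factor is split off.\<close>

lemma real_rootedI:
  assumes "p \<noteq> 0" and "\<And>z. poly (cpoly p) z = 0 \<Longrightarrow> z \<in> \<real>"
  shows "real_rooted p"
  using assms
proof (induction "degree p" arbitrary: p)
  case 0
  then obtain a where "p = [:a:]"
    by (metis degree_eq_zeroE)
  then have "p = smult a (\<Prod>r\<leftarrow>[]. [:-r, 1:])"
    by simp
  then show ?case
    unfolding real_rooted_def by blast
next
  case (Suc n)
  have "\<not> constant (poly (cpoly p))"
    using Suc.hyps(2) by (simp add: constant_degree degree_map_poly)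
  then obtain z where z: "poly (cpoly p) z = 0"
    using fundamental_theorem_of_algebra by blast
  then obtain r where r: "z = of_real r"
    using Suc.prems by (auto elim: Reals_cases)
  then have "poly p r = 0"
    using z by (simp add: poly_cpoly_of_real)
  then obtain q where q: "p = [:-r, 1:] * q"
    by (meson dvd_def poly_eq_0_iff_dvd)
  have "q \<noteq> 0"
    using q Suc.prems by auto
  then have "degree p = Suc (degree q)"
    unfolding q by (subst degree_mult_eq) auto
  moreover have "z \<in> \<real>" if "poly (cpoly q) z = 0" for z
    using that Suc.prems(2)[of z] unfolding q cpoly_mult by simp
  ultimately have "real_rooted q"
    using Suc.hyps \<open>q \<noteq> 0\<close> by auto
  then show ?case
    unfolding q by (rule real_rooted_mult_linear)
qed

text \<open>Here \<open>P'/P\<close> is the sum of the \<open>1/(z - r)\<close>, and each term has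
  negative imaginary part when \<open>Im z > 0\<close>. Multiplying by the squared modulus of
  \<open>P\<close> turns \<open>P'/P\<close> into \<open>P' * cnj P\<close>, which avoids
  division.\<close>

lemma Im_log_deriv_neg:
  assumes "Im z > 0"
  defines "P \<equiv> \<lambda>rs. (\<Prod>r\<leftarrow>rs. [:-r, 1:])"
  shows "poly (cpoly (P rs)) z \<noteq> 0 \<and>
    Im (poly (cpoly (pderiv (P rs))) z * cnj (poly (cpoly (P rs)) z)) \<le> 0 \<and>
    (rs \<noteq> [] \<longrightarrow> Im (poly (cpoly (pderiv (P rs))) z * cnj (poly (cpoly (P rs)) z)) < 0)"
proof (induction rs)
  case Nil
  then show ?case by (simp add: P_def)
next
  case (Cons r rs)
  define g where "g = poly (cpoly (P rs)) z"
  define g' where "g' = poly (cpoly (pderiv (P rs))) z"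
  define h where "h = z - of_real r"
  have "g \<noteq> 0" and le: "Im (g' * cnj g) \<le> 0"
    using Cons by (auto simp: g_def g'_def)
  have h: "h \<noteq> 0" "Im h > 0"
    using assms(1) by (auto simp: h_def complex_eq_iff)
  have P: "poly (cpoly (P (r # rs))) z = h * g"
    unfolding P_def list.map prod_list.Cons cpoly_mult cpoly_linear
    by (simp add: h_def g_def P_def left_diff_distrib)
  have "pderiv (P (r # rs)) = [:-r, 1:] * pderiv (P rs) + P rs"
    unfolding P_def list.map prod_list.Cons by (subst pderiv_mult) (simp add: pderiv_pCons)
  then have P': "poly (cpoly (pderiv (P (r # rs)))) z = h * g' + g"
    by (simp only: cpoly_add cpoly_mult cpoly_linear) (simp add: h_def g_def g'_def algebra_simps)
  \<comment> \<open>Divided by the squared modulus of \<open>h * g\<close>, this is the additivity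
    of the logarithmic derivative, \<open>g'/g + 1/h\<close>.\<close>
  have "(h * g' + g) * cnj (h * g) = (h * cnj h) * (g' * cnj g) + (g * cnj g) * cnj h"
    by (simp add: algebra_simps)
  also have "\<dots> = of_real ((cmod h)\<^sup>2) * (g' * cnj g) + of_real ((cmod g)\<^sup>2) * cnj h"
    by (simp add: complex_norm_square[symmetric] del: complex_cnj_mult)
  also have "Im \<dots> = (cmod h)\<^sup>2 * Im (g' * cnj g) - (cmod g)\<^sup>2 * Im h"
    by (simp only: plus_complex.sel Im_complex_of_real Re_complex_of_real times_complex.sel cnj.sel)
  also have "\<dots> < 0"
  proof -
    have "(cmod h)\<^sup>2 * Im (g' * cnj g) \<le> 0"
      using le by (simp add: mult_nonneg_nonpos del: times_complex.sel)
    moreover have "(cmod g)\<^sup>2 * Im h > 0"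
      using h \<open>g \<noteq> 0\<close> by simp
    ultimately show ?thesis by linarith
  qed
  finally show ?case
    unfolding P P' using \<open>g \<noteq> 0\<close> h by auto
qed

text \<open>A zero $z$ of $a p + b p'$ with $p(z) \neq 0$ makes $(p'/p)(z) = -a/b$ real, whereas
  $(p'/p)(z) = \sum 1/(z - r_i)$ has negative imaginary part in the upper half plane.\<close>

lemma real_rooted_add_pderiv:
  assumes "real_rooted p"
  shows "real_rooted (smult a p + smult b (pderiv p))"
proof (cases "b = 0 \<or> smult a p + smult b (pderiv p) = 0")
  case True
  then show ?thesis
    using assms real_rooted_smult by auto
next
  case False
  define q where "q = smult a p + smult b (pderiv p)"
  have "b \<noteq> 0" "q \<noteq> 0"
    using False by (auto simp: q_def)
  obtain c rs where p: "p = smult c (\<Prod>r\<leftarrow>rs. [:-r, 1:])"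
    using assms by (auto simp: real_rooted_def)
  define P where "P = (\<Prod>r\<leftarrow>rs. [:-r, 1:])"
  have q: "q = smult c (smult a P + smult b (pderiv P))"
    by (simp add: q_def p P_def pderiv_smult smult_add_right mult.commute)
  then have "c \<noteq> 0"
    using \<open>q \<noteq> 0\<close> by auto
  have upper: "poly (cpoly q) z \<noteq> 0" if z: "Im z > 0" for z
  proof (cases "rs = []")
    case True
    then have "q = [:c * a:]"
      by (simp add: q P_def)
    then show ?thesis
      using \<open>q \<noteq> 0\<close> by (simp add: map_poly_pCons)
  next
    case False
    define u where "u = poly (cpoly P) z"
    define v where "v = poly (cpoly (pderiv P)) z"
    have neg: "Im (v * cnj u) < 0"
      using Im_log_deriv_neg[OF z, of rs] False by (simp add: u_def v_def P_def)
    have "Im ((of_real a * u + of_real b * v) * cnj u) = b * Im (v * cnj u)"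
      by (simp add: algebra_simps)
    then have "of_real a * u + of_real b * v \<noteq> 0"
      using neg \<open>b \<noteq> 0\<close> by (metis mult_eq_0_iff less_irrefl mult_zero_left zero_complex.sel(2))
    then show ?thesis
      using \<open>c \<noteq> 0\<close> by (simp add: q cpoly_smult cpoly_add u_def v_def)
  qed
  have "real_rooted q"
  proof (rule real_rootedI[OF \<open>q \<noteq> 0\<close>])
    fix z assume z: "poly (cpoly q) z = 0"
    then have "poly (cpoly q) (cnj z) = 0"
      by (simp add: poly_cpoly_cnj)
    \<comment> \<open>Zeros of a real polynomial come in conjugate pairs, so excluding the upper
      half plane excludes the lower one too.\<close>
    then show "z \<in> \<real>"
      using z upper[of z] upper[of "cnj z"]
      by (metis complex_is_Real_iff complex_cnj cnj.sel(2) linorder_neqE_linordered_idom neg_0_less_iff_less)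
  qed
  then show ?thesis
    by (simp add: q_def)
qed

lemma real_rooted_pderiv: "real_rooted p \<Longrightarrow> real_rooted (pderiv p)"
  using real_rooted_add_pderiv[of p 0 1] by simp

lemma real_rooted_higher_pderiv: "real_rooted p \<Longrightarrow> real_rooted ((pderiv ^^ n) p)"
  by (induction n) (auto intro: real_rooted_pderiv)

lemma real_rooted_minus_pderiv2:
  assumes "real_rooted p" "c \<ge> 0"
  shows "real_rooted (p - smult c (pderiv (pderiv p)))"
proof -
  define d where "d = sqrt c"
  define q where "q = smult 1 p + smult d (pderiv p)"
  have "real_rooted (smult 1 q + smult (- d) (pderiv q))"
    unfolding q_def by (intro real_rooted_add_pderiv assms)
  also have "smult 1 q + smult (- d) (pderiv q) = p - smult (d * d) (pderiv (pderiv p))"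
    by (simp add: q_def pderiv_add pderiv_smult smult_add_right algebra_simps)
  also have "d * d = c"
    using assms by (simp add: d_def)
  finally show ?thesis .
qed

text \<open>Away from the roots, \<open>p'^2 - p p''\<close> equals \<open>p^2\<close> times the sum
  of the \<open>1/(a - r)^2\<close>. The induction avoids the division: for
  \<open>P = (X - r) Q\<close> the expression at \<open>a\<close> is \<open>Q^2\<close> plus
  \<open>(a - r)^2\<close> times the same expression for \<open>Q\<close>.\<close>

lemma laguerre_inequality:
  assumes "real_rooted p"
  shows "poly p a * poly (pderiv (pderiv p)) a \<le> (poly (pderiv p) a)\<^sup>2"
proof -
  obtain c rs where p: "p = smult c (\<Prod>r\<leftarrow>rs. [:-r, 1:])"
    using assms by (auto simp: real_rooted_def)
  have "poly P a * poly (pderiv (pderiv P)) a \<le> (poly (pderiv P) a)\<^sup>2"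
    if "P = (\<Prod>r\<leftarrow>rs. [:-r, 1:])" for P
    using that
  proof (induction rs arbitrary: P)
    case (Cons r rs)
    define Q where "Q = (\<Prod>r\<leftarrow>rs. [:-r, 1:])"
    have P: "P = [:-r, 1:] * Q"
      using Cons.prems by (simp add: Q_def)
    define g g' g'' h where "g = poly Q a" "g' = poly (pderiv Q) a"
      "g'' = poly (pderiv (pderiv Q)) a" "h = a - r"
    have P': "pderiv P = [:-r, 1:] * pderiv Q + Q"
      unfolding P by (subst pderiv_mult) (simp add: pderiv_pCons)
    have P'': "pderiv (pderiv P) = [:-r, 1:] * pderiv (pderiv Q) + 2 * pderiv Q"
      unfolding P' pderiv_add by (subst pderiv_mult) (simp add: pderiv_pCons)
    have "(poly (pderiv P) a)\<^sup>2 - poly P a * poly (pderiv (pderiv P)) a =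
      (h * g' + g)\<^sup>2 - (h * g) * (h * g'' + 2 * g')"
      unfolding P'' unfolding P' unfolding P
      by (simp only: poly_add poly_mult poly_numeral) (simp add: g_g'_g''_h_def)
    also have "\<dots> = g\<^sup>2 + h\<^sup>2 * (g'\<^sup>2 - g * g'')"
      by (simp add: power2_eq_square algebra_simps)
    also have "\<dots> \<ge> 0"
      using Cons.IH[OF Q_def] by (intro add_nonneg_nonneg mult_nonneg_nonneg) (auto simp: g_g'_g''_h_def)
    finally show ?case by simp
  qed auto
  note * = this[OF refl]
  show ?thesis
    unfolding p using mult_left_mono[OF *, of "c\<^sup>2"]
    by (simp add: pderiv_smult power2_eq_square mult_ac)
qed

subsection \<open>The backward heat flow on polynomials\<close>

lemma higher_pderiv_eq_0: "degree p < n \<Longrightarrow> (pderiv ^^ n) p = 0"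
  for p :: "real poly"
  by (rule poly_eqI) (simp add: coeff_higher_pderiv coeff_eq_0)

text \<open>This is $e^{-(t/2) D^2} p$, where the exponential series is finite on polynomials.\<close>

definition heat :: "real \<Rightarrow> real poly \<Rightarrow> real poly"
  where "heat t p = (\<Sum>k\<le>degree p. smult ((- t / 2) ^ k / fact k) ((pderiv ^^ (2 * k)) p))"

text \<open>Derivatives of order above the degree vanish, so the series may be cut off later. This
  brings polynomials of different degrees to a common summation range.\<close>

lemma heat_eq:
  assumes "degree p \<le> M"
  shows "heat t p = (\<Sum>k\<le>M. smult ((- t / 2) ^ k / fact k) ((pderiv ^^ (2 * k)) p))"
  unfolding heat_def using assms
  by (intro sum.mono_neutral_left) (auto simp: higher_pderiv_eq_0)

lemma heat_0 [simp]: "heat 0 p = p"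
proof -
  have "heat 0 p = (\<Sum>k\<le>degree p. if k = 0 then p else 0)"
    unfolding heat_def by (intro sum.cong) auto
  then show ?thesis by simp
qed

lemma higher_pderiv_commute: "(pderiv ^^ m) ((pderiv ^^ n) p) = (pderiv ^^ n) ((pderiv ^^ m) p)"
  by (metis add.commute comp_apply funpow_add)

text \<open>The flow is a power series in \<open>pderiv\<close> and therefore commutes with
  it.\<close>

lemma higher_pderiv_heat: "(pderiv ^^ n) (heat t p) = heat t ((pderiv ^^ n) p)"
proof -
  have "heat t ((pderiv ^^ n) p) =
      (\<Sum>k\<le>degree p. smult ((- t / 2) ^ k / fact k) ((pderiv ^^ (2 * k)) ((pderiv ^^ n) p)))"
    by (rule heat_eq) (simp add: degree_higher_pderiv)
  then show ?thesis
    unfolding heat_def higher_pderiv_sum higher_pderiv_smult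
    by (simp only: higher_pderiv_commute[of n])
qed

text \<open>This is the backward heat equation, obtained by differentiating the finite exponential
  sum term by term.\<close>

lemma has_real_derivative_poly_heat:
  "((\<lambda>t. poly (heat t p) a) has_real_derivative - (1/2) * poly (heat t (pderiv (pderiv p))) a) (at t)"
proof -
  \<comment> \<open>Once the constant term \<open>k = 0\<close> is split off, the shifted sum runs
    up to \<open>degree p\<close>, the range used for the second derivative of
    \<open>p\<close>.\<close>
  define M where "M = Suc (degree p)"
  define c where "c k = poly ((pderiv ^^ (2 * k)) p) a" for k
  have eq: "poly (heat t p) a = (\<Sum>k\<le>M. (- t / 2) ^ k / fact k * c k)" for t
    by (subst heat_eq[of _ M]) (auto simp: M_def poly_sum c_def)
  have "pderiv (pderiv p) = (pderiv ^^ 2) p"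
    by (simp add: numeral_2_eq_2)
  then have "(pderiv ^^ (2 * k)) (pderiv (pderiv p)) = (pderiv ^^ (2 * Suc k)) p" for k
    by (metis add.commute funpow_add comp_apply mult_Suc_right)
  then have eq2: "poly (heat t (pderiv (pderiv p))) a =
      (\<Sum>k\<le>degree p. (- t / 2) ^ k / fact k * c (Suc k))" for t
    by (subst heat_eq[of _ "degree p"]) (auto simp: poly_sum c_def degree_pderiv)
  have deriv: "((\<lambda>t. (- t / 2) ^ Suc k / fact (Suc k) * c (Suc k)) has_real_derivative
      - (1/2) * ((- t / 2) ^ k / fact k * c (Suc k))) (at t)" for k
  proof -
    have "((\<lambda>t. (- t / 2) ^ Suc k) has_real_derivative real (Suc k) * (- t / 2) ^ k * - (1/2)) (at t)"
      by (auto intro!: derivative_eq_intros simp del: power_Suc)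
    then have "((\<lambda>t. (- t / 2) ^ Suc k * (c (Suc k) / fact (Suc k))) has_real_derivative
        real (Suc k) * (- t / 2) ^ k * - (1/2) * (c (Suc k) / fact (Suc k))) (at t)"
      by (rule DERIV_cmult_right)
    then show ?thesis
      by (simp add: fact_Suc del: power_Suc of_nat_Suc)
  qed
  have "((\<lambda>t. c 0 + (\<Sum>k\<le>degree p. (- t / 2) ^ Suc k / fact (Suc k) * c (Suc k))) has_real_derivative
      0 + (\<Sum>k\<le>degree p. - (1/2) * ((- t / 2) ^ k / fact k * c (Suc k)))) (at t)"
    by (intro DERIV_add DERIV_const DERIV_sum deriv)
  then show ?thesis
    unfolding eq eq2 M_def sum.atMost_Suc_shift by (simp add: sum_distrib_left)
qed

lemma poly_cpoly_heat:
  "poly (cpoly (heat t p)) z =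
    (\<Sum>k\<le>degree p. of_real ((- t / 2) ^ k / fact k) * poly (cpoly ((pderiv ^^ (2 * k)) p)) z)"
  by (simp add: heat_def cpoly_sum cpoly_smult poly_sum)

lemma tendsto_poly_cpoly_heat:
  assumes "(f \<longlongrightarrow> t) F"
  shows "((\<lambda>n. poly (cpoly (heat (f n) p)) z) \<longlongrightarrow> poly (cpoly (heat t p)) z) F"
  unfolding poly_cpoly_heat by (intro tendsto_intros assms) auto

section \<open>Approximation of the heat flow by powers of \<open>1 - c D^2\<close>\<close>

text \<open>The binomial theorem for the operator \<open>1 - c D^2\<close>; terms with
  \<open>k > M\<close> vanish on \<open>p\<close>.\<close>

lemma minus_pderiv2_power:
  fixes p :: "real poly"
  assumes "degree p \<le> M"
  shows "((\<lambda>p. p - smult c (pderiv (pderiv p))) ^^ n) p =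
    (\<Sum>k\<le>M. smult (real (n choose k) * (- c) ^ k) ((pderiv ^^ (2 * k)) p))"
proof (induction n)
  case 0
  have "(\<Sum>k\<le>M. smult (real (0 choose k) * (- c) ^ k) ((pderiv ^^ (2 * k)) p)) =
      (\<Sum>k\<le>M. if k = 0 then p else 0)"
    by (intro sum.cong) (auto simp: binomial_eq_0)
  then show ?case by simp
next
  case (Suc n)
  define d where "d k = (pderiv ^^ (2 * k)) p" for k
  have d_Suc: "pderiv (pderiv (d k)) = d (Suc k)" for k
    by (simp add: d_def)
  have d0: "d (Suc M) = 0"
    using assms by (simp add: d_def higher_pderiv_eq_0 del: funpow.simps)
  define S where "S = (\<Sum>k\<le>M. smult (real (n choose k) * (- c) ^ k) (d k))"
  have S': "pderiv (pderiv S) = (\<Sum>k\<le>M. smult (real (n choose k) * (- c) ^ k) (d (Suc k)))"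
    by (simp add: S_def higher_pderiv_sum[of 1, simplified] pderiv_smult d_Suc)
  \<comment> \<open>The added term is zero by \<open>d0\<close>. Pascal's rule then splits the sum
    into \<open>S\<close> and, with the index shifted by one, \<open>- c D^2 S\<close>.\<close>
  have "(\<Sum>k\<le>M. smult (real (Suc n choose k) * (- c) ^ k) (d k)) =
      (\<Sum>k\<le>Suc M. smult (real (Suc n choose k) * (- c) ^ k) (d k))"
    by (simp add: d0)
  also have "\<dots> = d 0 + (\<Sum>k\<le>M. smult (real (n choose Suc k) * (- c) ^ Suc k) (d (Suc k)))
      + (\<Sum>k\<le>M. smult (real (n choose k) * (- c) ^ Suc k) (d (Suc k)))"
    unfolding sum.atMost_Suc_shift binomial_Suc_Suc of_nat_add distrib_right smult_add_left sum.distrib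
    by simp
  also have "d 0 + (\<Sum>k\<le>M. smult (real (n choose Suc k) * (- c) ^ Suc k) (d (Suc k))) =
      (\<Sum>k\<le>Suc M. smult (real (n choose k) * (- c) ^ k) (d k))"
    unfolding sum.atMost_Suc_shift by simp
  also have "\<dots> = S"
    by (simp add: d0 S_def)
  also have "(\<Sum>k\<le>M. smult (real (n choose k) * (- c) ^ Suc k) (d (Suc k))) =
      - smult c (pderiv (pderiv S))"
    unfolding S' by (simp add: poly_eq_iff coeff_sum sum_distrib_left sum_negf[symmetric] mult_ac)
  finally show ?case
    using Suc.IH by (simp add: S_def d_def)
qed

text \<open>Passing from \<open>k\<close> to \<open>Suc k\<close> multiplies the quotient by
  \<open>(1 - k/n) / (k + 1)\<close>, which tends to \<open>1 / (k + 1)\<close>.\<close>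

lemma tendsto_binomial_div_power: "(\<lambda>n. real (n choose k) / real n ^ k) \<longlonglongrightarrow> 1 / fact k"
proof (induction k)
  case (Suc k)
  have "(\<lambda>n. real (n choose k) / real n ^ k * ((1 - real k / real n) / real (Suc k)))
      \<longlonglongrightarrow> 1 / fact k * ((1 - 0) / real (Suc k))"
    by (intro tendsto_mult Suc tendsto_divide tendsto_diff tendsto_const lim_const_over_n) auto
  moreover have "\<forall>\<^sub>F n in sequentially. real (n choose k) / real n ^ k * ((1 - real k / real n) / real (Suc k)) =
      real (n choose Suc k) / real n ^ Suc k"
    using eventually_ge_at_top[of "Suc k"]
  proof eventually_elim
    case (elim n)
    have "Suc k * (n choose Suc k) = (n - k) * (n choose k)"
      by (metis binomial_absorb_comp binomial_absorption mult.commute)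
    then have "real (Suc k) * real (n choose Suc k) = (real n - real k) * real (n choose k)"
      using elim by (metis Suc_leD of_nat_diff of_nat_mult)
    then have "real (n choose Suc k) = (real n - real k) * real (n choose k) / real (Suc k)"
      by (simp add: nonzero_eq_divide_eq mult.commute del: of_nat_Suc)
    moreover have "1 - real k / real n = (real n - real k) / real n"
      using elim by (simp add: diff_divide_distrib)
    ultimately show ?case
      by (simp add: mult_ac del: of_nat_Suc)
  qed
  ultimately show ?case
    by (simp add: Lim_transform_eventually mult.commute)
qed auto

text \<open>Euler's limit for the exponential, applied to \<open>- (t/2) D^2\<close>. Only finitely
  many terms occur, so convergence of each coefficient suffices.\<close>

lemma tendsto_minus_pderiv2_power:
  "(\<lambda>n. poly (cpoly (((\<lambda>p. p - smult (t / (2 * real n)) (pderiv (pderiv p))) ^^ n) p)) z)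
    \<longlonglongrightarrow> poly (cpoly (heat t p)) z"
proof -
  have eq: "real (n choose k) * (- (t / (2 * real n))) ^ k = real (n choose k) / real n ^ k * (- t / 2) ^ k" for n k
    by (simp add: power_divide power_mult_distrib power_minus[of "t / _"] power_minus[of t])
  have "(\<lambda>n. real (n choose k) * (- (t / (2 * real n))) ^ k) \<longlonglongrightarrow> 1 / fact k * (- t / 2) ^ k" for k
    unfolding eq by (intro tendsto_intros tendsto_binomial_div_power)
  then show ?thesis
    unfolding poly_cpoly_heat minus_pderiv2_power[OF order_refl] cpoly_sum cpoly_smult poly_sum poly_smult
    by (intro tendsto_sum tendsto_mult tendsto_of_real tendsto_const) simp
qed

subsection \<open>Polynomials with prescribed roots\<close>

definition root_poly :: "real ^ 'n \<Rightarrow> real poly"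
  where "root_poly x = (\<Prod>i\<in>UNIV. [:- (x $ i), 1:])"

lemma poly_root_poly: "poly (root_poly x) z = (\<Prod>i\<in>UNIV. z - x $ i)"
  by (simp add: root_poly_def poly_prod)

lemma cpoly_prod: "cpoly (\<Prod>i\<in>A. f i) = (\<Prod>i\<in>A. cpoly (f i))"
  by (induction A rule: infinite_finite_induct) (auto simp: cpoly_mult)

lemma poly_cpoly_root_poly: "poly (cpoly (root_poly x)) z = (\<Prod>i\<in>UNIV. z - of_real (x $ i))"
  by (simp add: root_poly_def cpoly_prod cpoly_linear poly_prod)

lemma degree_root_poly: "degree (root_poly (x :: real ^ 'n)) = CARD('n)"
  unfolding root_poly_def by (subst degree_prod_eq_sum_degree) auto

lemma lead_coeff_root_poly: "lead_coeff (root_poly x) = 1"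
  unfolding root_poly_def by (subst lead_coeff_prod) auto

lemma root_poly_nonzero: "root_poly x \<noteq> 0"
  using lead_coeff_root_poly[of x] by auto

lemma real_rooted_root_poly: "real_rooted (root_poly x)"
proof -
  have "real_rooted (\<Prod>i\<in>A. [:- (x $ i), 1:])" if "finite A" for A
    using that
  proof (induction A)
    case empty
    have "(1 :: real poly) = smult 1 (\<Prod>r\<leftarrow>[]. [:- r, 1:])"
      by simp
    then have "real_rooted 1"
      unfolding real_rooted_def by blast
    then show ?case by simp
  next
    case (insert i A)
    then show ?case
      using real_rooted_mult_linear by (simp del: mult_pCons_left)
  qed
  then show ?thesis
    by (simp add: root_poly_def)
qed

section \<open>Ordered root vectors\<close>

text \<open>At the first index \<open>i\<close> where the vectors differ, the common factors before
  \<open>i\<close> cancel. The larger of the two \<open>i\<close>-th coordinates is a root of one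
  remaining product but exceeds every root of the other.\<close>

lemma weyl_chamber_A_root_poly_eqD:
  fixes x y :: "real ^ 'n::{finite,linorder}"
  assumes "x \<in> weyl_chamber_A" "y \<in> weyl_chamber_A" "root_poly x = root_poly y"
  shows "x = y"
proof (rule ccontr)
  define A where "A = {i. x $ i \<noteq> y $ i}"
  define i where "i = Min A"
  assume "x \<noteq> y"
  then have "A \<noteq> {}"
    by (auto simp: A_def vec_eq_iff)
  then have "i \<in> A"
    unfolding i_def by (intro Min_in) auto
  have less: "x $ j = y $ j" if "j < i" for j
  proof (rule ccontr)
    assume "x $ j \<noteq> y $ j"
    then have "j \<in> A"
      by (simp add: A_def)
    then have "i \<le> j"
      unfolding i_def by (intro Min_le) auto
    then show False
      using that by simp
  qed
  have *: False
    if "v \<in> weyl_chamber_A" and eq: "root_poly u = root_poly v"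
      and less: "\<And>j. j < i \<Longrightarrow> u $ j = v $ j" and gt: "u $ i > v $ i" for u v :: "real ^ 'n::{finite,linorder}"
  proof -
    define L where "L w = (\<Prod>j\<in>{..<i}. [:- (w $ j), 1:])" for w :: "real ^ 'n::{finite,linorder}"
    define R where "R w = (\<Prod>j\<in>{i..}. [:- (w $ j), 1:])" for w :: "real ^ 'n::{finite,linorder}"
    have split: "root_poly w = L w * R w" for w
    proof -
      have "(\<Prod>j\<in>{..<i} \<union> {i..}. [:- (w $ j), 1:]) = L w * R w"
        unfolding L_def R_def by (rule prod.union_disjoint) auto
      moreover have "{..<i} \<union> {i..} = UNIV"
        by auto
      ultimately show ?thesis
        unfolding root_poly_def by metis
    qed
    have "L u = L v"
      unfolding L_def using less by (intro prod.cong) auto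
    moreover have "L v \<noteq> 0"
      by (simp add: L_def)
    ultimately have "R u = R v"
      using eq by (simp add: split)
    then have "poly (R u) (u $ i) = poly (R v) (u $ i)"
      by simp
    moreover have "poly (R u) (u $ i) = 0"
      by (auto simp: R_def poly_prod)
    moreover have "poly (R v) (u $ i) > 0"
      unfolding R_def poly_prod
    proof (rule prod_pos)
      fix j assume "j \<in> {i..}"
      then have "v $ j \<le> v $ i"
        using \<open>v \<in> weyl_chamber_A\<close> by (cases "i = j") (auto simp: weyl_chamber_A_def)
      then show "0 < poly [:- (v $ j), 1:] (u $ i)"
        using gt by simp
    qed
    ultimately show False by simp
  qed
  have "x $ i \<noteq> y $ i"
    using \<open>i \<in> A\<close> by (simp add: A_def)
  then consider "x $ i > y $ i" | "y $ i > x $ i"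
    by linarith
  then show False
    using *[of y x] *[of x y] assms less by cases auto
qed

lemma degree_lead_coeff_prod_linear:
  "degree (\<Prod>r\<leftarrow>rs. [:-r, 1:]) = length rs \<and> lead_coeff (\<Prod>r\<leftarrow>rs. [:-r, 1::real:]) = 1"
proof (induction rs)
  case (Cons r rs)
  then have "(\<Prod>r\<leftarrow>rs. [:-r, 1::real:]) \<noteq> 0"
    by auto
  then show ?case
    using Cons unfolding list.map prod_list.Cons
    by (subst degree_mult_eq lead_coeff_mult; simp del: mult_pCons_left)+
qed auto

lemma ex_weyl_chamber_A_root_poly_eq:
  assumes "real_rooted p" "degree p = CARD('n::{finite,linorder})" "lead_coeff p = 1"
  obtains y :: "real ^ 'n::{finite,linorder}" where "y \<in> weyl_chamber_A" "root_poly y = p"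
proof -
  obtain c rs where p: "p = smult c (\<Prod>r\<leftarrow>rs. [:-r, 1:])"
    using assms(1) by (auto simp: real_rooted_def)
  have "c = 1"
    using assms(3) degree_lead_coeff_prod_linear[of rs] by (simp add: p split: if_splits)
  define xs where "xs = sort rs"
  have len: "length xs = CARD('n)"
    using assms(2) degree_lead_coeff_prod_linear[of rs] \<open>c = 1\<close> by (simp add: p xs_def)
  have "(\<Prod>r\<leftarrow>xs. [:-r, 1:]) = (\<Prod>r\<leftarrow>rs. [:-r, 1:])"
  proof -
    have "mset (map (\<lambda>r. [:-r, 1:]) xs) = mset (map (\<lambda>r. [:-r, 1:]) rs)"
      by (simp add: xs_def)
    then show ?thesis
      using prod_mset_prod_list by metis
  qed
  then have p: "p = (\<Prod>r\<leftarrow>xs. [:-r, 1:])"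
    by (simp add: p \<open>c = 1\<close>)
  \<comment> \<open>The list \<open>xs\<close> is ascending while coordinates must descend, so the
    position of an index is the number of indices after it.\<close>
  define rk where "rk i = card {j. i < j}" for i :: 'n
  have rk_less: "rk j < rk i" if "i < j" for i j
    unfolding rk_def using that by (intro psubset_card_mono) (auto intro: less_trans)
  have "inj rk"
    by (metis injI less_irrefl linorder_neqE rk_less)
  have rk_bound: "rk i < CARD('n)" for i
    unfolding rk_def by (intro psubset_card_mono) auto
  have bij: "bij_betw rk UNIV {..<CARD('n)}"
    unfolding bij_betw_def
  proof (intro conjI card_subset_eq)
    show "card (range rk) = card {..<CARD('n)}"
      using \<open>inj rk\<close> by (simp add: card_image)
  qed (use \<open>inj rk\<close> rk_bound in auto)
  define y :: "real ^ 'n::{finite,linorder}" where "y = (\<chi> i. xs ! rk i)"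
  have "xs ! rk j \<le> xs ! rk i" if "i < j" for i j
    using rk_less[OF that] rk_bound len by (intro sorted_nth_mono) (auto simp: xs_def)
  then have "y \<in> weyl_chamber_A"
    by (simp add: y_def weyl_chamber_A_def)
  moreover have "root_poly y = (\<Prod>k<CARD('n). [:- (xs ! k), 1:])"
    unfolding root_poly_def y_def by (simp add: prod.reindex_bij_betw[OF bij, of "\<lambda>k. [:- (xs ! k), 1:]"])
  moreover have "\<dots> = p"
    unfolding p by (subst prod.list_conv_set_nth) (simp add: len atLeast0LessThan)
  ultimately show ?thesis
    using that by metis
qed

section \<open>Continuous dependence of the roots on the polynomial\<close>

lemma closed_weyl_chamber_A: "closed (weyl_chamber_A :: (real ^ 'n::{finite,linorder}) set)"
  unfolding weyl_chamber_A_def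
  by (intro closed_Collect_all closed_Collect_imp closed_Collect_le continuous_intros) auto

text \<open>At $\mathrm i$ each factor of the polynomial has modulus at least $1$, so its value
  there bounds all the roots.\<close>

lemma abs_le_cmod_root_poly: "\<bar>x $ i\<bar> \<le> cmod (poly (cpoly (root_poly x)) \<i>)"
proof -
  have 1: "1 \<le> cmod (\<i> - of_real r)" for r
    using abs_Im_le_cmod[of "\<i> - of_real r"] by simp
  have "\<bar>x $ i\<bar> \<le> cmod (\<i> - of_real (x $ i))"
    using abs_Re_le_cmod[of "\<i> - of_real (x $ i)"] by simp
  also have "\<dots> * 1 \<le> cmod (\<i> - of_real (x $ i)) * (\<Prod>j\<in>UNIV - {i}. cmod (\<i> - of_real (x $ j)))"
    by (intro mult_left_mono prod_ge_1 1) auto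
  also have "\<dots> = cmod (poly (cpoly (root_poly x)) \<i>)"
    unfolding poly_cpoly_root_poly prod_norm[symmetric] by (rule prod.remove[symmetric]) auto
  finally show ?thesis by simp
qed

text \<open>The convergent values at \<open>\<i>\<close> bound the root vectors, so every
  subsequence has a convergent further subsequence; its limit is an ordered root vector of
  \<open>p\<close>, and there is only one such vector. The existence of \<open>l\<close> is part of
  the conclusion, so the lemma yields both real-rootedness of limits and continuity of
  roots.\<close>

lemma tendsto_root_polyE:
  fixes y :: "nat \<Rightarrow> real ^ 'n::{finite,linorder}"
  assumes y: "\<And>n. y n \<in> weyl_chamber_A"
    and lim: "\<And>z. (\<lambda>n. poly (cpoly (root_poly (y n))) z) \<longlonglongrightarrow> poly (cpoly p) z"
  obtains l where "l \<in> weyl_chamber_A" "root_poly l = p" "y \<longlonglongrightarrow> l"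
proof -
  have "Bseq (\<lambda>n. poly (cpoly (root_poly (y n))) \<i>)"
    using lim by (intro convergent_imp_Bseq) (auto simp: convergent_def)
  then obtain K where K: "\<And>n. cmod (poly (cpoly (root_poly (y n))) \<i>) \<le> K"
    by (auto simp: Bseq_def)
  have "norm (y n) \<le> real CARD('n) * K" for n
    using norm_le_l1_cart[of "y n"] sum_bounded_above[of UNIV "\<lambda>i. \<bar>y n $ i\<bar>" K]
      abs_le_cmod_root_poly[of "y n"] K[of n] by (meson order_trans)
  then have bounded: "bounded (range (y \<circ> s))" for s :: "nat \<Rightarrow> nat"
    unfolding bounded_iff by auto
  have sub: "\<exists>r l. strict_mono r \<and> (y \<circ> s \<circ> r) \<longlonglongrightarrow> l \<and> l \<in> weyl_chamber_A \<and> root_poly l = p"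
    if s: "strict_mono s" for s :: "nat \<Rightarrow> nat"
  proof -
    obtain l r where r: "strict_mono r" and l: "(y \<circ> s \<circ> r) \<longlonglongrightarrow> l"
      using bounded_imp_convergent_subsequence[OF bounded[of s]] by blast
    have "l \<in> weyl_chamber_A"
      using closed_sequentially[OF closed_weyl_chamber_A _ l] y by auto
    moreover have "poly (root_poly l) z = poly p z" for z
    proof -
      have "(\<lambda>n. poly (root_poly (y n)) z) \<longlonglongrightarrow> poly p z"
        using lim[of "of_real z"] by (simp add: poly_cpoly_of_real tendsto_of_real_iff)
      then have "(\<lambda>n. poly (root_poly (y ((s \<circ> r) n))) z) \<longlonglongrightarrow> poly p z"
        using LIMSEQ_subseq_LIMSEQ[OF _ strict_mono_o[OF s r]] by (fastforce simp: o_def)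
      moreover have "(\<lambda>n. poly (root_poly (y ((s \<circ> r) n))) z) \<longlonglongrightarrow> poly (root_poly l) z"
        unfolding poly_root_poly using l by (intro tendsto_intros) (auto simp: o_def)
      ultimately show ?thesis
        using LIMSEQ_unique by blast
    qed
    then have "root_poly l = p"
      by (simp add: poly_eq_poly_eq_iff[symmetric] fun_eq_iff)
    ultimately show ?thesis
      using r l by blast
  qed
  obtain l :: "real ^ 'n::{finite,linorder}" where l: "l \<in> weyl_chamber_A" "root_poly l = p"
    using sub[OF strict_mono_id] by blast
  have "y \<longlonglongrightarrow> l"
  proof (rule ccontr)
    assume "\<not> y \<longlonglongrightarrow> l"
    then obtain e where "e > 0" and e: "\<And>N. \<exists>n\<ge>N. dist (y n) l \<ge> e"
      by (auto simp: lim_sequentially not_less)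
    \<comment> \<open>A subsequence keeping distance \<open>e\<close> from \<open>l\<close> would
      have a further subsequence tending to an ordered root vector of \<open>p\<close>, hence to
      \<open>l\<close>.\<close>
    then have "infinite {n. dist (y n) l \<ge> e}"
      unfolding infinite_nat_iff_unbounded_le by auto
    then obtain s :: "nat \<Rightarrow> nat" where s: "strict_mono s" "\<And>n. dist (y (s n)) l \<ge> e"
      using infinite_enumerate by blast
    then obtain r l' where l': "(y \<circ> s \<circ> r) \<longlonglongrightarrow> l'" "l' \<in> weyl_chamber_A" "root_poly l' = p"
      using sub by blast
    then have "l' = l"
      using weyl_chamber_A_root_poly_eqD l by metis
    then have "(\<lambda>n. dist (y (s (r n))) l) \<longlonglongrightarrow> 0"
      using l'(1) by (simp add: o_def tendsto_dist_iff[symmetric])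
    then have "e \<le> 0"
      by (rule LIMSEQ_le_const) (use s in auto)
    then show False
      using \<open>e > 0\<close> by simp
  qed
  then show ?thesis
    using that l by blast
qed

section \<open>Real and simple roots along the heat flow\<close>

text \<open>The approximants \<open>(1 - (t/2n) D^2)^n\<close> applied to \<open>root_poly x\<close>
  stay monic and real-rooted of degree \<open>CARD('n)\<close>, so they have ordered root vectors;
  these converge by \<open>tendsto_root_polyE\<close>.\<close>

lemma ex_root_poly_eq_heat:
  fixes x :: "real ^ 'n::{finite,linorder}"
  assumes "t \<ge> 0"
  obtains y :: "real ^ 'n::{finite,linorder}" where "y \<in> weyl_chamber_A" "root_poly y = heat t (root_poly x)"
proof -
  define T where "T c p = p - smult c (pderiv (pderiv p))" for c and p :: "real poly"
  define inv where "inv p \<longleftrightarrow> real_rooted p \<and> degree p = CARD('n) \<and> lead_coeff p = 1" for p :: "real poly"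
  have step: "inv (T c p)" if "inv p" "c \<ge> 0" for c p
  proof -
    define q where "q = smult (- c) (pderiv (pderiv p))"
    \<comment> \<open>Subtraction is truncated here; positivity of \<open>degree p\<close> makes the
      bound strict, so adding \<open>q\<close> changes neither degree nor leading
      coefficient.\<close>
    have "degree q \<le> degree p - 2"
      unfolding q_def using degree_smult_le[of "- c" "pderiv (pderiv p)"] by (simp add: degree_pderiv)
    moreover have "degree p > 0"
      using that by (simp add: inv_def)
    ultimately have q: "degree q < degree p"
      by simp
    have "real_rooted (T c p)"
      using that real_rooted_minus_pderiv2 by (simp add: inv_def T_def)
    moreover have T: "T c p = q + p"
      by (simp add: T_def q_def)
    ultimately show ?thesis
      using that lead_coeff_add_le[OF q] degree_add_eq_right[OF q] unfolding inv_def T by auto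
  qed
  have "inv ((T c ^^ n) (root_poly x))" if "c \<ge> 0" for c n
  proof (induction n)
    case 0
    show ?case
      using real_rooted_root_poly degree_root_poly lead_coeff_root_poly by (auto simp: inv_def)
  next
    case (Suc n)
    then show ?case
      using step[OF _ that] by simp
  qed
  then have inv: "inv ((T (t / (2 * real n)) ^^ n) (root_poly x))" for n
    using assms by simp
  have "\<exists>y::real ^ 'n::{finite,linorder}. y \<in> weyl_chamber_A \<and> root_poly y = (T (t / (2 * real n)) ^^ n) (root_poly x)" for n
  proof -
    obtain y :: "real ^ 'n::{finite,linorder}"
      where "y \<in> weyl_chamber_A" "root_poly y = (T (t / (2 * real n)) ^^ n) (root_poly x)"
      using inv[of n] unfolding inv_def by (elim conjE) (rule ex_weyl_chamber_A_root_poly_eq)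
    then show ?thesis by blast
  qed
  then obtain y :: "nat \<Rightarrow> real ^ 'n::{finite,linorder}" where y: "\<And>n. y n \<in> weyl_chamber_A"
    "\<And>n. root_poly (y n) = (T (t / (2 * real n)) ^^ n) (root_poly x)"
    by metis
  have lim: "(\<lambda>n. poly (cpoly (root_poly (y n))) z) \<longlonglongrightarrow> poly (cpoly (heat t (root_poly x))) z" for z
    unfolding y(2) T_def by (rule tendsto_minus_pderiv2_power)
  obtain l :: "real ^ 'n::{finite,linorder}"
    where "l \<in> weyl_chamber_A" "root_poly l = heat t (root_poly x)"
    by (rule tendsto_root_polyE[where y = y, OF y(1) lim])
  then show ?thesis
    by (rule that)
qed

text \<open>If $a$ were a root of multiplicity $m \ge 2$ at time $t$, then $f = D^{m-2} p$ would
  have a double root there. The Laguerre expression $f'^2 - f f''$ at $a$ then vanishes at time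
  $t$ with time derivative $f''(a)^2/2 > 0$, so it is negative shortly before.\<close>

lemma heat_simple_roots:
  assumes "t > 0" and rr: "\<And>\<tau>. \<tau> \<ge> 0 \<Longrightarrow> real_rooted (heat \<tau> p)"
    and "heat t p \<noteq> 0" "poly (heat t p) a = 0"
  shows "poly (pderiv (heat t p)) a \<noteq> 0"
proof
  assume zero': "poly (pderiv (heat t p)) a = 0"
  define q where "q = heat t p"
  \<comment> \<open>This is the multiplicity of the root \<open>a\<close>. Such a \<open>k\<close>
    exists because the derivative of order \<open>degree q\<close> is a nonzero constant.\<close>
  define m where "m = (LEAST k. poly ((pderiv ^^ k) q) a \<noteq> 0)"
  have "degree ((pderiv ^^ degree q) q) = 0"
    by (simp add: degree_higher_pderiv)
  then obtain b where b: "(pderiv ^^ degree q) q = [:b:]"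
    by (metis degree_eq_zeroE)
  have "coeff ((pderiv ^^ degree q) q) 0 \<noteq> 0"
    using assms(3) by (simp add: coeff_higher_pderiv q_def pochhammer_eq_0_iff del: of_nat_Suc)
  then have "poly ((pderiv ^^ degree q) q) a \<noteq> 0"
    by (simp add: b)
  then have m: "poly ((pderiv ^^ m) q) a \<noteq> 0"
    unfolding m_def by (rule LeastI)
  have below: "poly ((pderiv ^^ k) q) a = 0" if "k < m" for k
    using that not_less_Least unfolding m_def by blast
  have "m \<noteq> 0"
    using m assms(4) by (cases "m = 0") (auto simp: q_def)
  moreover have "m \<noteq> 1"
    using m zero' by (cases "m = 1") (auto simp: q_def)
  ultimately obtain n where n: "m = Suc (Suc n)"
    by (metis One_nat_def not0_implies_Suc)
  define r where "r = (pderiv ^^ n) p"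
  define u where "u \<tau> = poly (heat \<tau> r) a" for \<tau>
  define v where "v \<tau> = poly (heat \<tau> (pderiv r)) a" for \<tau>
  define w where "w \<tau> = poly (heat \<tau> (pderiv (pderiv r))) a" for \<tau>
  have commute: "heat \<tau> (pderiv s) = pderiv (heat \<tau> s)" for \<tau> s
    using higher_pderiv_heat[of 1 \<tau> s] by simp
  have "heat t r = (pderiv ^^ n) q"
    by (simp add: r_def q_def higher_pderiv_heat)
  then have t0: "u t = 0" "v t = 0" "w t \<noteq> 0"
    using below[of n] below[of "Suc n"] m unfolding u_def v_def w_def commute by (auto simp: n)
  have "((\<lambda>\<tau>. (v \<tau>)\<^sup>2 - u \<tau> * w \<tau>) has_real_derivative
      2 * v t * (- (1/2) * poly (heat t (pderiv (pderiv (pderiv r)))) a)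
        - (- (1/2) * w t * w t + - (1/2) * poly (heat t (pderiv (pderiv (pderiv (pderiv r))))) a * u t)) (at t)"
    unfolding u_def v_def w_def
    by (auto intro!: derivative_eq_intros has_real_derivative_poly_heat)
  then have "((\<lambda>\<tau>. (v \<tau>)\<^sup>2 - u \<tau> * w \<tau>) has_real_derivative (w t)\<^sup>2 / 2) (at t)"
    by (simp add: t0 power2_eq_square)
  then have "\<exists>d>0. \<forall>h>0. h < d \<longrightarrow> (v (t - h))\<^sup>2 - u (t - h) * w (t - h) < (v t)\<^sup>2 - u t * w t"
    by (rule DERIV_pos_inc_left) (simp add: t0)
  then obtain d where "d > 0" and d: "\<And>h. h > 0 \<Longrightarrow> h < d \<Longrightarrow>
      (v (t - h))\<^sup>2 - u (t - h) * w (t - h) < (v t)\<^sup>2 - u t * w t"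
    by blast
  \<comment> \<open>The cap \<open>t\<close> keeps the earlier time \<open>t - h\<close>
    nonnegative, where real-rootedness is known.\<close>
  define h where "h = min (d / 2) t"
  have h: "h > 0" "h < d" "t - h \<ge> 0"
    using \<open>d > 0\<close> \<open>t > 0\<close> by (auto simp: h_def)
  have "real_rooted (heat (t - h) r)"
    unfolding r_def higher_pderiv_heat[symmetric] by (intro real_rooted_higher_pderiv rr h)
  then have "u (t - h) * w (t - h) \<le> (v (t - h))\<^sup>2"
    unfolding u_def v_def w_def commute by (rule laguerre_inequality)
  then show False
    using d[OF h(1,2)] t0 by simp
qed

text \<open>Two equal coordinates would give a double root, at which the derivative
  vanishes.\<close>

lemma weyl_interior_AI:
  assumes "y \<in> weyl_chamber_A"
    and simple: "\<And>a. poly (root_poly y) a = 0 \<Longrightarrow> poly (pderiv (root_poly y)) a \<noteq> 0"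
  shows "y \<in> weyl_interior_A"
proof -
  have False if "i < j" "y $ i = y $ j" for i j
  proof -
    define a where "a = y $ i"
    define g where "g = (\<Prod>k\<in>UNIV - {i} - {j}. [:- (y $ k), 1:])"
    have "root_poly y = [:- a, 1:] * (\<Prod>k\<in>UNIV - {i}. [:- (y $ k), 1:])"
      unfolding root_poly_def a_def by (rule prod.remove) auto
    also have "(\<Prod>k\<in>UNIV - {i}. [:- (y $ k), 1:]) = [:- a, 1:] * g"
      unfolding g_def a_def that(2) using that(1) by (intro prod.remove) auto
    finally have "root_poly y = [:- a, 1:] * ([:- a, 1:] * g)" .
    then show False
      using simple[of a] by (simp add: pderiv_mult pderiv_pCons del: mult_pCons_left)
  qed
  moreover have "y $ j \<le> y $ i" if "i < j" for i j
    using that assms(1) by (simp add: weyl_chamber_A_def)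
  ultimately have "y $ j < y $ i" if "i < j" for i j
    using that by (metis order_le_less)
  then show ?thesis
    by (simp add: weyl_interior_A_def)
qed

subsection \<open>The ordinary differential equation\<close>

text \<open>With \<open>a = x t $ i\<close> fixed,
  \<open>poly (heat s p) a = (a - x s $ i) * R s\<close>. Continuity of \<open>R\<close> thus turns
  the heat equation at \<open>a\<close> into the derivative of the root. The limit is
  \<open>p''(a) / (2 R t)\<close>, where \<open>p''(a)\<close> is twice the derivative at
  \<open>a\<close> of the cofactor \<open>g\<close>.\<close>

lemma has_real_derivative_root:
  fixes x :: "real \<Rightarrow> real ^ 'n::{finite,linorder}"
  assumes heat: "\<And>s. s \<ge> 0 \<Longrightarrow> root_poly (x s) = heat s p"
    and "t > 0" "isCont x t" "x t \<in> weyl_interior_A"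
  shows "((\<lambda>s. x s $ i) has_real_derivative (\<Sum>j\<in>UNIV - {i}. 1 / (x t $ i - x t $ j))) (at t)"
proof -
  define a where "a = x t $ i"
  define R where "R s = (\<Prod>j\<in>UNIV - {i}. a - x s $ j)" for s
  define g where "g = (\<Prod>j\<in>UNIV - {i}. [:- (x t $ j), 1:])"
  have neq: "a \<noteq> x t $ j" if "j \<in> UNIV - {i}" for j
    using that assms(4) unfolding a_def weyl_interior_A_def
    by (metis (mono_tags, lifting) DiffE insertI1 less_irrefl linorder_neqE mem_Collect_eq)
  have "R t \<noteq> 0"
    using neq by (simp add: R_def)
  have R_lim: "(R \<longlongrightarrow> R t) (at t)"
    unfolding R_def using assms(3) by (intro tendsto_intros) (auto simp: isCont_def)
  have factor: "poly (heat s p) a = (a - x s $ i) * R s" if "s \<ge> 0" for s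
    unfolding heat[OF that, symmetric] poly_root_poly R_def by (rule prod.remove) auto
  have g: "root_poly (x t) = [:- a, 1:] * g"
    unfolding root_poly_def g_def a_def by (rule prod.remove) auto
  have "poly g a = R t"
    by (simp add: g_def R_def poly_prod)
  have "poly (pderiv g) a = (\<Sum>j\<in>UNIV - {i}. \<Prod>k\<in>UNIV - {i} - {j}. a - x t $ k)"
    by (simp add: g_def pderiv_prod poly_sum poly_prod pderiv_pCons)
  also have "\<dots> = (\<Sum>j\<in>UNIV - {i}. R t * (1 / (a - x t $ j)))"
  proof (rule sum.cong[OF refl])
    fix j assume j: "j \<in> UNIV - {i}"
    then have "R t = (a - x t $ j) * (\<Prod>k\<in>UNIV - {i} - {j}. a - x t $ k)"
      unfolding R_def by (intro prod.remove) auto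
    then show "(\<Prod>k\<in>UNIV - {i} - {j}. a - x t $ k) = R t * (1 / (a - x t $ j))"
      using neq[OF j] by simp
  qed
  finally have g': "poly (pderiv g) a = R t * (\<Sum>j\<in>UNIV - {i}. 1 / (a - x t $ j))"
    by (simp add: sum_distrib_left)
  have "pderiv (root_poly (x t)) = [:- a, 1:] * pderiv g + g"
    unfolding g by (subst pderiv_mult) (simp add: pderiv_pCons)
  then have "pderiv (pderiv (root_poly (x t))) = [:- a, 1:] * pderiv (pderiv g) + 2 * pderiv g"
    by (simp only: pderiv_add) (subst pderiv_mult, simp add: pderiv_pCons)
  then have "poly (pderiv (pderiv (heat t p))) a = 2 * poly (pderiv g) a"
    using heat[of t] \<open>t > 0\<close> by (simp del: mult_pCons_left)
  moreover have "heat t (pderiv (pderiv p)) = pderiv (pderiv (heat t p))"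
    using higher_pderiv_heat[of 2 t p] by (simp add: numeral_2_eq_2)
  ultimately have "((\<lambda>s. poly (heat s p) a) has_real_derivative - poly (pderiv g) a) (at t)"
    using has_real_derivative_poly_heat[of p a t] by simp
  then have "((\<lambda>s. (poly (heat s p) a - poly (heat t p) a) / (s - t)) \<longlongrightarrow> - poly (pderiv g) a) (at t)"
    by (simp add: has_field_derivative_iff)
  then have lim: "((\<lambda>s. - ((poly (heat s p) a - poly (heat t p) a) / (s - t)) / R s)
      \<longlongrightarrow> - (- poly (pderiv g) a) / R t) (at t)"
    by (intro tendsto_divide tendsto_minus R_lim \<open>R t \<noteq> 0\<close>)
  have lim_eq: "- (- poly (pderiv g) a) / R t = (\<Sum>j\<in>UNIV - {i}. 1 / (x t $ i - x t $ j))"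
    using \<open>R t \<noteq> 0\<close> by (simp add: g' flip: a_def)
  have "\<forall>\<^sub>F s in at t. s > 0"
    using eventually_at_in_open'[of "{0<..}" t] \<open>t > 0\<close> by simp
  with tendsto_imp_eventually_ne[OF R_lim \<open>R t \<noteq> 0\<close>]
  have "\<forall>\<^sub>F s in at t. - ((poly (heat s p) a - poly (heat t p) a) / (s - t)) / R s =
      (x s $ i - x t $ i) / (s - t)"
  proof eventually_elim
    case (elim s)
    have "poly (heat s p) a - poly (heat t p) a = (a - x s $ i) * R s"
      using factor[of s] factor[of t] elim \<open>t > 0\<close> by (simp add: a_def)
    then have "- ((poly (heat s p) a - poly (heat t p) a) / (s - t)) / R s = - ((a - x s $ i) / (s - t))"
      using elim by simp
    also have "\<dots> = (x s $ i - x t $ i) / (s - t)"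
      by (metis minus_diff_eq minus_divide_left a_def)
    finally show ?case .
  qed
  then show ?thesis
    unfolding has_field_derivative_iff by (rule Lim_transform_eventually[OF lim[unfolded lim_eq]])
qed

section \<open>Monotonicity of the right-hand side and uniqueness\<close>

text \<open>Symmetrizing the double sum leaves, for each pair, \<open>(u - v) * (1/u - 1/v)\<close>
  with coordinate gaps \<open>u\<close>, \<open>v\<close> of equal sign. This is nonpositive because
  the reciprocal decreases on the positive reals.\<close>

lemma sum_diff_inverse_diff_nonpos:
  fixes a b :: "real ^ 'n::{finite,linorder}"
  assumes "a \<in> weyl_interior_A" "b \<in> weyl_interior_A"
  shows "(\<Sum>i\<in>UNIV. (a $ i - b $ i) *
    ((\<Sum>j\<in>UNIV - {i}. 1 / (a $ i - a $ j)) - (\<Sum>j\<in>UNIV - {i}. 1 / (b $ i - b $ j)))) \<le> 0"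
proof -
  define d where "d i = a $ i - b $ i" for i
  define h where "h i j = 1 / (a $ i - a $ j) - 1 / (b $ i - b $ j)" for i j
  have antisym: "h i j = - h j i" for i j
  proof -
    have "1 / (p - q) = - (1 / (q - p))" for p q :: real
      by (metis minus_diff_eq minus_divide_right)
    from this[of "a $ i" "a $ j"] this[of "b $ i" "b $ j"] show ?thesis
      unfolding h_def by linarith
  qed
  \<comment> \<open>The diagonal term may be added since \<open>1 / 0 = 0\<close> makes
    \<open>h i i\<close> zero.\<close>
  have "(\<Sum>j\<in>UNIV - {i}. 1 / (a $ i - a $ j)) - (\<Sum>j\<in>UNIV - {i}. 1 / (b $ i - b $ j)) = (\<Sum>j\<in>UNIV. h i j)" for i
    unfolding h_def by (simp add: sum_subtractf sum.remove[of UNIV i])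
  then have S: "(\<Sum>i\<in>UNIV. d i * ((\<Sum>j\<in>UNIV - {i}. 1 / (a $ i - a $ j)) - (\<Sum>j\<in>UNIV - {i}. 1 / (b $ i - b $ j))))
      = (\<Sum>i\<in>UNIV. \<Sum>j\<in>UNIV. d i * h i j)" (is "?S = _")
    by (simp add: sum_distrib_left)
  also have "\<dots> = (\<Sum>j\<in>UNIV. \<Sum>i\<in>UNIV. d i * h i j)"
    by (rule sum.swap)
  also have "\<dots> = (\<Sum>i\<in>UNIV. \<Sum>j\<in>UNIV. - (d j * h i j))"
    by (intro sum.cong refl) (subst antisym, simp)
  finally have "2 * ?S = (\<Sum>i\<in>UNIV. \<Sum>j\<in>UNIV. (d i - d j) * h i j)"
    using S by (simp add: sum.distrib[symmetric] left_diff_distrib sum_subtractf sum_negf)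
  also have "\<dots> \<le> 0"
  proof (intro sum_nonpos)
    fix i j
    have less: "(d i - d j) * h i j \<le> 0" if "i < j" for i j
    proof -
      define u v where "u = a $ i - a $ j" "v = b $ i - b $ j"
      have pos: "u > 0" "v > 0"
        using assms that by (auto simp: u_v_def weyl_interior_A_def)
      have "(d i - d j) * h i j = (u - v) * (1 / u - 1 / v)"
        by (simp add: d_def h_def u_v_def algebra_simps)
      also have "\<dots> = - ((u - v)\<^sup>2 / (u * v))"
        using pos by (simp add: field_simps power2_eq_square)
      also have "\<dots> \<le> 0"
        using pos by simp
      finally show ?thesis .
    qed
    have "(d i - d j) * h i j = (d j - d i) * h j i"
      by (subst antisym) (simp add: left_diff_distrib)
    then show "(d i - d j) * h i j \<le> 0"
      using less[of i j] less[of j i] by (cases i j rule: linorder_cases) auto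
  qed
  finally show ?thesis
    by (simp add: d_def)
qed

lemma weyl_flow_unique:
  fixes x y :: "real \<Rightarrow> real ^ 'n::{finite,linorder}"
  assumes cont: "continuous_on {0..} x" "continuous_on {0..} y" and init: "x 0 = y 0"
    and int: "\<And>t. t > 0 \<Longrightarrow> x t \<in> weyl_interior_A" "\<And>t. t > 0 \<Longrightarrow> y t \<in> weyl_interior_A"
    and deriv: "\<And>t i. t > 0 \<Longrightarrow> ((\<lambda>s. x s $ i) has_real_derivative
        (\<Sum>j\<in>UNIV - {i}. 1 / (x t $ i - x t $ j))) (at t)"
      "\<And>t i. t > 0 \<Longrightarrow> ((\<lambda>s. y s $ i) has_real_derivative
        (\<Sum>j\<in>UNIV - {i}. 1 / (y t $ i - y t $ j))) (at t)"
    and "t \<ge> 0"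
  shows "x t = y t"
proof -
  define D where "D s = (\<Sum>i\<in>UNIV. (x s $ i - y s $ i)\<^sup>2)" for s
  have "D t \<le> D 0"
  \<comment> \<open>At time \<open>0\<close> the ODE may be singular, so differentiability is used
    only inside the interval, together with continuity up to \<open>0\<close>.\<close>
  proof (rule DERIV_nonpos_imp_decreasing_open[OF \<open>t \<ge> 0\<close>])
    fix s :: real assume "0 < s"
    define S where "S = (\<Sum>i\<in>UNIV. (x s $ i - y s $ i) *
      ((\<Sum>j\<in>UNIV - {i}. 1 / (x s $ i - x s $ j)) - (\<Sum>j\<in>UNIV - {i}. 1 / (y s $ i - y s $ j))))"
    have "(D has_real_derivative 2 * S) (at s)"
      unfolding D_def S_def
      by (auto intro!: derivative_eq_intros deriv \<open>0 < s\<close> simp: sum_distrib_left mult_ac)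
    moreover have "S \<le> 0"
      unfolding S_def using int \<open>0 < s\<close> by (intro sum_diff_inverse_diff_nonpos)
    ultimately show "\<exists>l. (D has_real_derivative l) (at s) \<and> l \<le> 0"
      by (intro exI[of _ "2 * S"]) simp
  next
    show "continuous_on {0..t} D"
      unfolding D_def
      by (intro continuous_intros continuous_on_subset[OF cont(1)] continuous_on_subset[OF cont(2)]) auto
  qed
  then have "D t = 0"
    using sum_nonneg[of UNIV "\<lambda>i. (x t $ i - y t $ i)\<^sup>2"] by (simp add: D_def init)
  then show ?thesis
    by (simp add: D_def sum_nonneg_eq_0_iff vec_eq_iff)
qed

section \<open>Existence and uniqueness of the flow\<close>

theorem theorem2p8:
  fixes x0 :: "real ^ 'n::{finite,linorder}"
  assumes "CARD('n::{finite,linorder}) \<ge> 2"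
    and "x0 \<in> weyl_chamber_A"
  shows "\<exists>!x :: real \<Rightarrow> real ^ 'n::{finite,linorder}.
           x \<in> {0..} \<rightarrow>\<^sub>E weyl_chamber_A \<and>
           continuous_on {0..} x \<and>
           x 0 = x0 \<and>
           (\<forall>t>0. x t \<in> weyl_interior_A) \<and>
           (\<forall>t>0. \<forall>i. ((\<lambda>s. x s $ i) has_real_derivative
              (\<Sum>j\<in>UNIV - {i}. 1 / (x t $ i - x t $ j))) (at t))"
proof (rule ex_ex1I)
  define p where "p = root_poly x0"
  have "\<exists>y::real ^ 'n::{finite,linorder}. y \<in> weyl_chamber_A \<and> root_poly y = heat t p" if "t \<ge> 0" for t
    using ex_root_poly_eq_heat[OF that, of x0] unfolding p_def by blast
  then obtain X :: "real \<Rightarrow> real ^ 'n::{finite,linorder}" where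
    X: "\<And>t. t \<ge> 0 \<Longrightarrow> X t \<in> weyl_chamber_A" "\<And>t. t \<ge> 0 \<Longrightarrow> root_poly (X t) = heat t p"
    by metis
  \<comment> \<open>Restriction fixes the value \<open>undefined\<close> at negative times, as
    \<open>\<rightarrow>\<^sub>E\<close> demands; this makes uniqueness meaningful for total
    functions.\<close>
  define x where "x = restrict X {0..}"
  have x: "x t \<in> weyl_chamber_A" "root_poly (x t) = heat t p" if "t \<ge> 0" for t
    using X that by (auto simp: x_def)
  have "x 0 = x0"
    using x[of 0] assms(2) by (intro weyl_chamber_A_root_poly_eqD) (auto simp: p_def)
  have cont: "continuous_on {0..} x"
    unfolding continuous_on_sequentially o_def
  proof (intro allI ballI impI, elim conjE)
    fix u :: "nat \<Rightarrow> real" and t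
    assume t: "t \<in> {0..}" and u: "\<forall>n. u n \<in> {0..}" "u \<longlonglongrightarrow> t"
    have lim: "(\<lambda>n. poly (cpoly (root_poly (x (u n)))) z) \<longlonglongrightarrow> poly (cpoly (root_poly (x t))) z" for z
      using tendsto_poly_cpoly_heat[OF u(2)] u(1) t by (simp add: x)
    have chamber: "x (u n) \<in> weyl_chamber_A" for n
      using u(1) x by simp
    \<comment> \<open>The limit is an ordered root vector of the polynomial at time
      \<open>t\<close>, and therefore equals \<open>x t\<close>.\<close>
    obtain l where l: "l \<in> weyl_chamber_A" "root_poly l = root_poly (x t)" "(\<lambda>n. x (u n)) \<longlonglongrightarrow> l"
      by (rule tendsto_root_polyE[where y = "\<lambda>n. x (u n)", OF chamber lim])
    then show "(\<lambda>n. x (u n)) \<longlonglongrightarrow> x t"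
      using weyl_chamber_A_root_poly_eqD[OF l(1) _ l(2)] t x by simp
  qed
  have int: "x t \<in> weyl_interior_A" if "t > 0" for t
  proof (rule weyl_interior_AI)
    show "x t \<in> weyl_chamber_A"
      using that x by simp
    have rr: "real_rooted (heat s p)" if "s \<ge> 0" for s
      using x(2)[OF that] real_rooted_root_poly by metis
    fix a assume "poly (root_poly (x t)) a = 0"
    then show "poly (pderiv (root_poly (x t))) a \<noteq> 0"
      using heat_simple_roots[OF that rr, of a] x(2)[of t] root_poly_nonzero[of "x t"] that by simp
  qed
  have "isCont x t" if "t > 0" for t
    using continuous_on_interior[OF cont] that by simp
  then have deriv: "((\<lambda>s. x s $ i) has_real_derivative (\<Sum>j\<in>UNIV - {i}. 1 / (x t $ i - x t $ j))) (at t)"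
    if "t > 0" for t i
    using that int by (intro has_real_derivative_root[of x p] x(2)) auto
  have ext: "x \<in> {0..} \<rightarrow>\<^sub>E weyl_chamber_A"
    using x(1) by (auto simp: x_def)
  show "\<exists>x :: real \<Rightarrow> real ^ 'n::{finite,linorder}.
           x \<in> {0..} \<rightarrow>\<^sub>E weyl_chamber_A \<and>
           continuous_on {0..} x \<and>
           x 0 = x0 \<and>
           (\<forall>t>0. x t \<in> weyl_interior_A) \<and>
           (\<forall>t>0. \<forall>i. ((\<lambda>s. x s $ i) has_real_derivative
              (\<Sum>j\<in>UNIV - {i}. 1 / (x t $ i - x t $ j))) (at t))"
    by (intro exI[of _ x] conjI allI impI ext cont \<open>x 0 = x0\<close> int deriv)
next
  fix x y :: "real \<Rightarrow> real ^ 'n::{finite,linorder}"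
  assume x: "x \<in> {0..} \<rightarrow>\<^sub>E weyl_chamber_A \<and>
           continuous_on {0..} x \<and>
           x 0 = x0 \<and>
           (\<forall>t>0. x t \<in> weyl_interior_A) \<and>
           (\<forall>t>0. \<forall>i. ((\<lambda>s. x s $ i) has_real_derivative
              (\<Sum>j\<in>UNIV - {i}. 1 / (x t $ i - x t $ j))) (at t))"
    and y: "y \<in> {0..} \<rightarrow>\<^sub>E weyl_chamber_A \<and>
           continuous_on {0..} y \<and>
           y 0 = x0 \<and>
           (\<forall>t>0. y t \<in> weyl_interior_A) \<and>
           (\<forall>t>0. \<forall>i. ((\<lambda>s. y s $ i) has_real_derivative
              (\<Sum>j\<in>UNIV - {i}. 1 / (y t $ i - y t $ j))) (at t))"
  have eq: "x t = y t" if "t \<ge> 0" for t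
  proof (rule weyl_flow_unique[of x y])
    show "x 0 = y 0"
      using x y by metis
  qed (use x y that in blast)+
  show "x = y"
    by (rule PiE_ext[OF x[THEN conjunct1] y[THEN conjunct1]]) (simp add: eq)
qed

end
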